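(* Let $G$ be a finite simple graph with $\operatorname{mad}(G) < 25/4$. Then $\tau(G) \leq 2\nu(G)$.
   Context: $\nu(G)$ is the maximum number of pairwise edge-disjoint triangles in $G$. $\tau(G)$ is the minimum size of an edge set $Y \subseteq E(G)$ such that $G - Y$ is triangle-free. The maximum average degree is $\operatorname{mad}(G) = \max\{2|E(H)|/|V(H)| : H \subseteq G,\ V(H)\neq\emptyset\}$. *)

theory Defs
  imports Complex_Main "HOL-Library.Disjoint_Sets"
begin

definition simple_graph :: "'a set \<Rightarrow> 'a set set \<Rightarrow> bool" where
  "simple_graph V E \<longleftrightarrow> finite V \<and> (\<forall>e\<in>E. e \<subseteq> V \<and> card e = 2)"

definition tri_edges :: "'a \<Rightarrow> 'a \<Rightarrow> 'a \<Rightarrow> 'a set set" where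
  "tri_edges a b c = {{a, b}, {b, c}, {a, c}}"

definition triangles :: "'a set set \<Rightarrow> 'a set set set" where
  "triangles E = {tri_edges a b c | a b c. a \<noteq> b \<and> b \<noteq> c \<and> a \<noteq> c \<and> tri_edges a b c \<subseteq> E}"

definition triangle_free :: "'a set set \<Rightarrow> bool" where
  "triangle_free E \<longleftrightarrow> triangles E = {}"

definition tri_packing_number :: "'a set set \<Rightarrow> nat" where
  "tri_packing_number E =
     Max {card T | T. T \<subseteq> triangles E \<and> disjoint T}"

definition tri_cover_number :: "'a set set \<Rightarrow> nat" where
  "tri_cover_number E = Min {card Y | Y. Y \<subseteq> E \<and> triangle_free (E - Y)}"

definition mad :: "'a set \<Rightarrow> 'a set set \<Rightarrow> real" where
  "mad V E = Max {2 * real (card E') / real (card V') | V' E'.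
                   V' \<subseteq> V \<and> V' \<noteq> {} \<and> E' \<subseteq> E \<and> (\<forall>e\<in>E'. e \<subseteq> V')}"

end

theory Submission
  imports Defs
begin

text \<open>
  Let \<open>E\<close> be a minimal counterexample. A vertex set \<open>V\<^sub>0\<close> is reducible if there are edge-disjoint
  triangles \<open>S\<close> and at most \<open>2|S|\<close> edges \<open>X\<close> such that \<open>X\<close> meets every triangle touching \<open>V\<^sub>0\<close> and
  contains every edge of \<open>S\<close> that avoids \<open>V\<^sub>0\<close>; deleting \<open>V\<^sub>0\<close> and \<open>X\<close> then gives a smaller
  counterexample. With \<open>V\<^sub>0 = {v}\<close>, a matching \<open>M\<close> in the neighbourhood of \<open>v\<close> together with
  at most \<open>|M|\<close> vertices covering all other edges there yields a reduction, so every vertex of degree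
  at most 6 has degree 5 or 6 and a neighbourhood that is complete up to a matching. With
  \<open>V\<^sub>0 = {u, v}\<close> one finds that no two vertices of degree at most 6 are adjacent and that a
  vertex of degree 7 has at most three such neighbours. If every vertex of degree at least 7 now
  sends charge 1/4 to each neighbour of degree at most 6, all vertices end up with at least 25/4.
\<close>

section \<open>Packings and covers given by witnesses\<close>

text \<open>Explicit witnesses replace the \<open>Max\<close> and \<open>Min\<close> behind \<nu>
  and \<tau>, so that a packing and a cover of a subgraph can be enlarged directly.\<close>

definition tuza :: "'a set set \<Rightarrow> bool" where
  "tuza E \<longleftrightarrow> (\<exists>T Y. T \<subseteq> triangles E \<and> disjoint T \<and> Y \<subseteq> E \<and> triangle_free (E - Y) \<and>
     card Y \<le> 2 * card T)"

text \<open>A list of edges lets one \<open>distinct\<close> on a concatenation express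
  edge-disjointness of a whole packing, which the simplifier can check on concrete
  configurations.\<close>

definition tri_list :: "'a \<times> 'a \<times> 'a \<Rightarrow> 'a set list" where
  "tri_list = (\<lambda>(a, b, c). [{a, b}, {b, c}, {a, c}])"

lemma tri_list_simp [simp]: "tri_list (a, b, c) = [{a, b}, {b, c}, {a, c}]"
  by (simp add: tri_list_def)

lemma triangles_mono: "E \<subseteq> F \<Longrightarrow> triangles E \<subseteq> triangles F"
  unfolding triangles_def by blast

lemma disjoint_packing_of_list:
  assumes "distinct (concat (map tri_list ts))"
  shows "disjoint ((set \<circ> tri_list) ` set ts)" "card ((set \<circ> tri_list) ` set ts) = length ts"
proof -
  have "disjoint ((set \<circ> tri_list) ` set ts) \<and> card ((set \<circ> tri_list) ` set ts) = length ts"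
    using assms
  proof (induction ts)
    case (Cons t ts)
    have ne: "set (tri_list t) \<noteq> {}"
      by (cases t) simp
    have IH: "disjoint ((set \<circ> tri_list) ` set ts)"
      "card ((set \<circ> tri_list) ` set ts) = length ts"
      using Cons by auto
    have dj: "set (tri_list t) \<inter> B = {}" if "B \<in> (set \<circ> tri_list) ` set ts" for B
      using Cons.prems that by auto
    then have "set (tri_list t) \<notin> (set \<circ> tri_list) ` set ts"
      using ne by (metis inf.idem)
    moreover have "disjoint (insert (set (tri_list t)) ((set \<circ> tri_list) ` set ts))"
      using IH(1) dj unfolding disjoint_def by blast
    ultimately show ?case
      using IH(2) by simp
  qed simp
  then show "disjoint ((set \<circ> tri_list) ` set ts)"
    "card ((set \<circ> tri_list) ` set ts) = length ts" by auto
qed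

section \<open>Minimal counterexamples and reductions\<close>

locale tuza_critical =
  fixes E :: "'a set set"
  assumes finite_edges: "finite E"
    and card_edge: "e \<in> E \<Longrightarrow> card e = 2"
    and not_tuza: "\<not> tuza E"
    and tuza_subgraph: "E' \<subset> E \<Longrightarrow> tuza E'"
begin

definition nbr :: "'a \<Rightarrow> 'a set" where
  "nbr v = {w. {v, w} \<in> E}"

lemma edge_neq: "{x, y} \<in> E \<Longrightarrow> x \<noteq> y"
  using card_edge by fastforce

text \<open>By minimality \<open>E'\<close> has a packing \<open>T\<close> and a cover
  \<open>Y\<close>. The triangles \<open>ts\<close> use no edge of \<open>E'\<close>, so they extend
  \<open>T\<close>; a triangle missed by \<open>X\<close> lies inside \<open>E'\<close> and is hit
  by \<open>Y\<close>. With at most two new cover edges per new triangle, \<open>E\<close> would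
  satisfy \<open>tuza\<close>.\<close>

lemma reduction:
  assumes sub: "E' \<subset> E"
    and dist: "distinct (concat (map tri_list ts))"
    and tsE: "set (concat (map tri_list ts)) \<subseteq> E - E'"
    and len: "length X \<le> 2 * length ts"
    and cov: "\<And>a b c. {a, b} \<in> E \<Longrightarrow> {b, c} \<in> E \<Longrightarrow> {a, c} \<in> E \<Longrightarrow>
      tri_edges a b c \<inter> set X \<noteq> {} \<or> tri_edges a b c \<subseteq> E'"
  shows False
proof -
  obtain T Y where T: "T \<subseteq> triangles E'" "disjoint T" and Y: "Y \<subseteq> E'" "triangle_free (E' - Y)"
    and YT: "card Y \<le> 2 * card T"
    using tuza_subgraph[OF sub] unfolding tuza_def by blast
  define S where "S = (set \<circ> tri_list) ` set ts"
  note S = disjoint_packing_of_list[OF dist, folded S_def]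
  have S_tri: "S \<subseteq> triangles E"
  proof
    fix s assume "s \<in> S"
    then obtain t where t: "t \<in> set ts" "s = set (tri_list t)"
      unfolding S_def by auto
    obtain a b c where "t = (a, b, c)"
      by (cases t)
    then have abc: "s = tri_edges a b c"
      using t by (simp add: tri_edges_def)
    have "s \<subseteq> E"
      using tsE t by auto
    moreover have "a \<noteq> b" "b \<noteq> c" "a \<noteq> c"
      using \<open>s \<subseteq> E\<close> edge_neq abc unfolding tri_edges_def by auto
    ultimately show "s \<in> triangles E"
      unfolding triangles_def using abc by blast
  qed
  have S_E': "s \<inter> E' = {}" if "s \<in> S" for s
    using that tsE unfolding S_def by auto
  have T_E': "t \<subseteq> E'" "t \<noteq> {}" if "t \<in> T" for t
    using that T(1) unfolding triangles_def tri_edges_def by auto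
  have "finite S" unfolding S_def by simp
  have "finite T"
  proof (rule finite_subset)
    show "T \<subseteq> Pow E" using T_E' sub by blast
  qed (use finite_edges in simp)
  have "S \<inter> T = {}"
    using S_E' T_E' by blast
  then have card_ST: "card (S \<union> T) = length ts + card T"
    using S(2) \<open>finite S\<close> \<open>finite T\<close> by (simp add: card_Un_disjoint)
  have "tuza E"
    unfolding tuza_def
  proof (intro exI conjI)
    show "S \<union> T \<subseteq> triangles E"
      using S_tri T(1) triangles_mono[of E' E] sub by (meson Un_least psubset_imp_subset subset_trans)
    have "s \<inter> t = {}" if "s \<in> S" "t \<in> T" for s t
      using S_E'[OF that(1)] T_E'(1)[OF that(2)] by auto
    then have "\<Union>S \<inter> \<Union>T = {}"
      by auto
    then show "disjoint (S \<union> T)"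
      using S(1) T(2) by (rule disjoint_union[rotated 2])
    show "(set X \<inter> E) \<union> Y \<subseteq> E"
      using Y(1) sub by blast
    have "card ((set X \<inter> E) \<union> Y) \<le> card (set X \<inter> E) + card Y"
      by (rule card_Un_le)
    also have "card (set X \<inter> E) \<le> length X"
      by (meson List.finite_set Int_lower1 card_length card_mono le_trans)
    finally show "card ((set X \<inter> E) \<union> Y) \<le> 2 * card (S \<union> T)"
      using len YT card_ST by simp
    have False if "t \<in> triangles (E - (set X \<inter> E \<union> Y))" for t
    proof -
      obtain a b c where abc: "t = tri_edges a b c" "a \<noteq> b" "b \<noteq> c" "a \<noteq> c"
        "tri_edges a b c \<subseteq> E - (set X \<inter> E \<union> Y)"
        using \<open>t \<in> _\<close> unfolding triangles_def by blast
      then have "tri_edges a b c \<inter> set X = {}" by blast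
      then have "tri_edges a b c \<subseteq> E' - Y"
        using cov[of a b c] abc(5) unfolding tri_edges_def by auto
      then show False
        using Y(2) abc unfolding triangle_free_def triangles_def by blast
    qed
    then show "triangle_free (E - (set X \<inter> E \<union> Y))"
      unfolding triangle_free_def by blast
  qed
  then show False
    using not_tuza by simp
qed

text \<open>An edge in no triangle could be deleted at no cost: \<open>reduction\<close> with empty
  packing and empty cover.\<close>

lemma edge_in_triangle:
  assumes "{v, w} \<in> E"
  obtains x where "x \<in> nbr v" "x \<in> nbr w"
proof (rule ccontr)
  assume "\<not> thesis"
  then have no: "\<not> ({v, x} \<in> E \<and> {w, x} \<in> E)" for x
    using that unfolding nbr_def by blast
  show False
  proof (rule reduction[of "E - {{v, w}}" "[]" "[]"])
    fix a b c assume "{a, b} \<in> E" "{b, c} \<in> E" "{a, c} \<in> E"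
    then have "{v, w} \<notin> tri_edges a b c"
      using no[of a] no[of b] no[of c] unfolding tri_edges_def
      by (auto simp: doubleton_eq_iff insert_commute)
    then show "tri_edges a b c \<inter> set [] \<noteq> {} \<or> tri_edges a b c \<subseteq> E - {{v, w}}"
      using \<open>{a, b} \<in> E\<close> \<open>{b, c} \<in> E\<close> \<open>{a, c} \<in> E\<close> unfolding tri_edges_def by auto
  qed (use assms in auto)
qed

text \<open>This is \<open>reduction\<close> where \<open>E'\<close> consists of the edges outside
  \<open>X\<close> that avoid \<open>V\<^sub>0\<close>. The first hypothesis makes \<open>E'\<close>
  a proper subset, \<open>out\<close> keeps the packing off \<open>E'\<close>, and
  \<open>cov\<close> handles triangles touching \<open>V\<^sub>0\<close>; any other triangle meets
  \<open>X\<close> or lies in \<open>E'\<close>.\<close>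

lemma reducible:
  assumes "V\<^sub>0 \<inter> \<Union>E \<noteq> {}"
    and dist: "distinct (concat (map tri_list ts))"
    and tsE: "set (concat (map tri_list ts)) \<subseteq> E"
    and len: "length X \<le> 2 * length ts"
    and out: "\<forall>e\<in>set (concat (map tri_list ts)). e \<inter> V\<^sub>0 = {} \<longrightarrow> e \<in> set X"
    and cov: "\<forall>w\<in>V\<^sub>0. \<forall>p\<in>nbr w. \<forall>q\<in>nbr w. {p, q} \<in> E \<longrightarrow>
      {w, p} \<in> set X \<or> {w, q} \<in> set X \<or> {p, q} \<in> set X"
  shows False
proof (rule reduction[of "{e \<in> E - set X. e \<inter> V\<^sub>0 = {}}" ts X])
  show "{e \<in> E - set X. e \<inter> V\<^sub>0 = {}} \<subset> E"
    using assms(1) by blast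
  show "set (concat (map tri_list ts)) \<subseteq> E - {e \<in> E - set X. e \<inter> V\<^sub>0 = {}}"
    using tsE out by blast
  fix a b c assume E: "{a, b} \<in> E" "{b, c} \<in> E" "{a, c} \<in> E"
  show "tri_edges a b c \<inter> set X \<noteq> {} \<or> tri_edges a b c \<subseteq> {e \<in> E - set X. e \<inter> V\<^sub>0 = {}}"
  proof (cases "a \<in> V\<^sub>0 \<or> b \<in> V\<^sub>0 \<or> c \<in> V\<^sub>0")
    case True
    then show ?thesis
      using cov[rule_format, of a b c] cov[rule_format, of b a c] cov[rule_format, of c a b] E
      by (auto simp: tri_edges_def nbr_def insert_commute)
  next
    case False
    then show ?thesis
      using E by (auto simp: tri_edges_def)
  qed
qed (use dist len in auto)

text \<open>The packing consists of the triangles \<open>v a b\<close> over a matching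
  \<open>M\<close> in the link of \<open>v\<close> (the graph on its neighbours). The cover takes
  the edges of \<open>M\<close> and the spokes from \<open>v\<close> to \<open>Q\<close>.\<close>

lemma weak_Koenig_Egervary_reducible:
  assumes "nbr v \<noteq> {}"
    and "distinct (concat (map (\<lambda>(a, b). [a, b]) M))"
    and "\<And>a b. (a, b) \<in> set M \<Longrightarrow> a \<in> nbr v \<and> b \<in> nbr v \<and> {a, b} \<in> E"
    and "length Q \<le> length M"
    and "\<And>p q. p \<in> nbr v \<Longrightarrow> q \<in> nbr v \<Longrightarrow> {p, q} \<in> E \<Longrightarrow>
      p \<in> set Q \<or> q \<in> set Q \<or> (p, q) \<in> set M \<or> (q, p) \<in> set M"
  shows False
proof (rule reducible[of "{v}" "map (\<lambda>(a, b). (v, a, b)) M"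
      "map (\<lambda>(a, b). {a, b}) M @ map (\<lambda>q. {v, q}) Q"])
  show "{v} \<inter> \<Union>E \<noteq> {}"
    using assms(1) unfolding nbr_def by blast
  have v: "v \<notin> nbr v"
    unfolding nbr_def using edge_neq by blast
  show "distinct (concat (map tri_list (map (\<lambda>(a, b). (v, a, b)) M)))"
    using assms(2,3)
  proof (induction M)
    case (Cons m M)
    obtain a b where m: "m = (a, b)" by (cases m)
    have ab: "a \<noteq> v" "b \<noteq> v" "a \<noteq> b"
      using Cons.prems(1) Cons.prems(2)[of a b] v m by auto
    have cd: "c \<noteq> v \<and> d \<noteq> v \<and> {a, b} \<inter> {c, d} = {}" if "(c, d) \<in> set M" for c d
      using that Cons.prems(1) Cons.prems(2)[of c d] v m by fastforce
    have "distinct (concat (map tri_list (map (\<lambda>(a, b). (v, a, b)) M)))"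
      using Cons by auto
    then show ?case
      using ab cd m by (fastforce simp: doubleton_eq_iff)
  qed simp
  show "set (concat (map tri_list (map (\<lambda>(a, b). (v, a, b)) M))) \<subseteq> E"
    using assms(3) unfolding nbr_def by fastforce
  show "length (map (\<lambda>(a, b). {a, b}) M @ map (\<lambda>q. {v, q}) Q)
    \<le> 2 * length (map (\<lambda>(a, b). (v, a, b)) M)"
    using assms(4) by simp
  show "\<forall>e\<in>set (concat (map tri_list (map (\<lambda>(a, b). (v, a, b)) M))). e \<inter> {v} = {} \<longrightarrow>
      e \<in> set (map (\<lambda>(a, b). {a, b}) M @ map (\<lambda>q. {v, q}) Q)"
    by force
  show "\<forall>w\<in>{v}. \<forall>p\<in>nbr w. \<forall>q\<in>nbr w. {p, q} \<in> E \<longrightarrow>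
      {w, p} \<in> set (map (\<lambda>(a, b). {a, b}) M @ map (\<lambda>q. {v, q}) Q) \<or>
      {w, q} \<in> set (map (\<lambda>(a, b). {a, b}) M @ map (\<lambda>q. {v, q}) Q) \<or>
      {p, q} \<in> set (map (\<lambda>(a, b). {a, b}) M @ map (\<lambda>q. {v, q}) Q)"
  proof (intro ballI impI)
    fix w p q assume w: "w \<in> {v}" and pq: "p \<in> nbr w" "q \<in> nbr w" "{p, q} \<in> E"
    then have "p \<in> set Q \<or> q \<in> set Q \<or> (p, q) \<in> set M \<or> (q, p) \<in> set M"
      using assms(5)[of p q] by simp
    moreover have "{p, q} \<in> (\<lambda>(a, b). {a, b}) ` set M" if "(p, q) \<in> set M \<or> (q, p) \<in> set M"
      using that by (auto simp: insert_commute image_iff intro: bexI[of _ "(p, q)"] bexI[of _ "(q, p)"])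
    ultimately show "{w, p} \<in> set (map (\<lambda>(a, b). {a, b}) M @ map (\<lambda>q. {v, q}) Q) \<or>
      {w, q} \<in> set (map (\<lambda>(a, b). {a, b}) M @ map (\<lambda>q. {v, q}) Q) \<or>
      {p, q} \<in> set (map (\<lambda>(a, b). {a, b}) M @ map (\<lambda>q. {v, q}) Q)"
      using w by auto
  qed
qed

section \<open>Links of vertices of degree at most 6\<close>

lemma nbr_sym: "w \<in> nbr v \<longleftrightarrow> v \<in> nbr w"
  by (simp add: nbr_def insert_commute)

lemma nbr_irrefl: "v \<notin> nbr v"
  using edge_neq[of v v] by (auto simp: nbr_def)

definition matching :: "'a set \<Rightarrow> ('a \<times> 'a) list \<Rightarrow> bool" where
  "matching C M \<longleftrightarrow> distinct (concat (map (\<lambda>(a, b). [a, b]) M)) \<and>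
     (\<forall>(a, b) \<in> set M. a \<in> C \<and> b \<in> C \<and> {a, b} \<in> E)"

text \<open>Contrapositive of the preceding reduction, in the form used below: \<open>M\<close> and
  \<open>Q\<close> are chosen so that no place is left for the edge \<open>{p, q}\<close>.\<close>

lemma link_not_weak_Koenig_Egervary:
  assumes "nbr v \<noteq> {}" "matching (nbr v) M" "length Q \<le> length M"
  obtains p q where "p \<in> nbr v" "q \<in> nbr v" "{p, q} \<in> E" "p \<notin> set Q" "q \<notin> set Q"
    "(p, q) \<notin> set M" "(q, p) \<notin> set M"
proof (rule ccontr)
  assume "\<not> thesis"
  note no = this that
  show False
  proof (rule weak_Koenig_Egervary_reducible[OF assms(1) _ _ assms(3)])
    show "distinct (concat (map (\<lambda>(a, b). [a, b]) M))"
      using assms(2) by (simp add: matching_def)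
    show "a \<in> nbr v \<and> b \<in> nbr v \<and> {a, b} \<in> E" if "(a, b) \<in> set M" for a b
      using assms(2) that by (auto simp: matching_def)
    show "p \<in> set Q \<or> q \<in> set Q \<or> (p, q) \<in> set M \<or> (q, p) \<in> set M"
      if "p \<in> nbr v" "q \<in> nbr v" "{p, q} \<in> E" for p q
      using no that by blast
  qed
qed

text \<open>The non-edges inside \<open>C\<close> form a matching: no vertex of \<open>C\<close>
  misses two others.\<close>

definition co_matching :: "'a set \<Rightarrow> bool" where
  "co_matching C \<longleftrightarrow> (\<forall>x\<in>C. \<forall>y\<in>C. \<forall>z\<in>C. x \<noteq> y \<longrightarrow> x \<noteq> z \<longrightarrow> y \<noteq> z \<longrightarrow>
     {x, y} \<in> E \<or> {x, z} \<in> E)"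

text \<open>Pairwise intersecting edges form a star or a triangle. Either way one edge and one
  vertex account for the whole link, contrary to \<open>link_not_weak_Koenig_Egervary\<close> with a
  matching of size 1.\<close>

lemma link_matching_2:
  assumes "nbr v \<noteq> {}"
  obtains a b c d where "matching (nbr v) [(a, b), (c, d)]"
proof (rule ccontr)
  assume "\<not> thesis"
  then have no2: "\<not> matching (nbr v) [(a, b), (c, d)]" for a b c d
    using that by blast
  have "\<exists>a b c. matching (nbr v) [(a, b)] \<and>
    (\<forall>x y. x \<in> nbr v \<longrightarrow> y \<in> nbr v \<longrightarrow> {x, y} \<in> E \<longrightarrow> c \<in> {x, y} \<or> {x, y} = {a, b})"
  proof -
    obtain w where w: "w \<in> nbr v" using assms by blast
    then obtain b where b: "b \<in> nbr v" "b \<in> nbr w"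
      using edge_in_triangle[of v w] unfolding nbr_def by blast
    have wb: "{w, b} \<in> E" "w \<noteq> b" using b edge_neq by (auto simp: nbr_def)
    show ?thesis
    proof (cases "\<forall>x y. x \<in> nbr v \<longrightarrow> y \<in> nbr v \<longrightarrow> {x, y} \<in> E \<longrightarrow> w \<in> {x, y} \<or> {x, y} = {w, b}")
      case True
      then show ?thesis using w b wb by (intro exI[of _ w] exI[of _ b]) (auto simp: matching_def)
    next
      case False
      then obtain x y where xy: "x \<in> nbr v" "y \<in> nbr v" "{x, y} \<in> E" "x \<noteq> w" "y \<noteq> w" by blast
      have "x \<noteq> y" using xy edge_neq by blast
      have "b = x \<or> b = y"
        using no2[of w b x y] w b wb xy \<open>x \<noteq> y\<close> by (auto simp: matching_def)
      then obtain c where c: "c \<in> nbr v" "{b, c} \<in> E" "c \<noteq> w" "c \<noteq> b"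
        using xy \<open>x \<noteq> y\<close> by (auto simp: insert_commute)
      show ?thesis
      \<comment> \<open>Every link edge meets both edges of the path \<open>w b c\<close>, so it
        contains \<open>b\<close> or equals \<open>{w, c}\<close>.\<close>
      proof (cases "{w, c} \<in> E")
        case True
        have "b \<in> {x, y} \<or> {x, y} = {w, c}"
          if "x \<in> nbr v" "y \<in> nbr v" "{x, y} \<in> E" for x y
          using no2[of w b x y] no2[of b c x y] that w b wb c True edge_neq[OF that(3)]
          by (auto simp: matching_def)
        then show ?thesis using w c True
          by (intro exI[of _ w] exI[of _ c] exI[of _ b]) (auto simp: matching_def)
      next
        case False
        have "b \<in> {x, y}"
          if "x \<in> nbr v" "y \<in> nbr v" "{x, y} \<in> E" for x y
          using no2[of w b x y] no2[of b c x y] that w b wb c False edge_neq[OF that(3)]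
          by (auto simp: matching_def insert_commute)
        then show ?thesis using w wb b
          by (intro exI[of _ w] exI[of _ b] exI[of _ b]) (auto simp: matching_def)
      qed
    qed
  qed
  then obtain a b c where abc: "matching (nbr v) [(a, b)]"
    "\<And>x y. x \<in> nbr v \<Longrightarrow> y \<in> nbr v \<Longrightarrow> {x, y} \<in> E \<Longrightarrow> c \<in> {x, y} \<or> {x, y} = {a, b}"
    by blast
  obtain p q where "p \<in> nbr v" "q \<in> nbr v" "{p, q} \<in> E" "p \<notin> set [c]" "q \<notin> set [c]"
    "(p, q) \<notin> set [(a, b)]" "(q, p) \<notin> set [(a, b)]"
    using link_not_weak_Koenig_Egervary[OF assms abc(1), of "[c]"] by auto
  then show False
    using abc(2)[of p q] by (auto simp: doubleton_eq_iff)
qed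

text \<open>A matching \<open>a b\<close>, \<open>c d\<close> leaves two vertices \<open>e\<close>,
  \<open>f\<close>. Absence of a perfect matching forbids many link edges, and however
  \<open>e\<close> and \<open>f\<close> are attached to the matched vertices, two vertices and a
  matching of size 2 account for the rest.\<close>

lemma link_matching_3:
  assumes "card (nbr v) = 6"
  obtains a b c d e f where "matching (nbr v) [(a, b), (c, d), (e, f)]"
proof (rule ccontr)
  assume "\<not> thesis"
  then have no3: "\<not> matching (nbr v) [(a, b), (c, d), (e, f)]" for a b c d e f
    using that by blast
  have ne: "nbr v \<noteq> {}" using assms by auto
  have fin: "finite (nbr v)" using assms by (simp add: card_ge_0_finite)
  obtain a b c d where M: "matching (nbr v) [(a, b), (c, d)]"
    using link_matching_2[OF ne] .
  then have abcd: "distinct [a, b, c, d]" "{a, b, c, d} \<subseteq> nbr v" "{a, b} \<in> E" "{c, d} \<in> E"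
    by (auto simp: matching_def)
  have "card (nbr v - {a, b, c, d}) = 2"
    using abcd assms by (subst card_Diff_subset) auto
  then obtain e f where ef: "nbr v - {a, b, c, d} = {e, f}" "e \<noteq> f"
    by (auto simp: card_2_iff)
  have N: "nbr v = {a, b, c, d, e, f}" using ef abcd by auto
  have dist: "distinct [a, b, c, d, e, f]" using abcd ef by auto

  \<comment> \<open>Here \<open>e\<close> and \<open>f\<close> hang on different matching edges. The
    vertices \<open>a\<close>, \<open>c\<close> cover every link edge except possibly
    \<open>b e\<close> and \<open>d f\<close>; these enter the matching as \<open>m1\<close> and
    \<open>m2\<close> when present, with \<open>a b\<close> and \<open>c d\<close> as defaults that
    keep its size at 2.\<close>
  have main: False
    if N: "nbr v = {a, b, c, d, e, f}" and dist: "distinct [a, b, c, d, e, f]"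
      and ab: "{a, b} \<in> E" and cd: "{c, d} \<in> E" and ae: "{a, e} \<in> E" and cf: "{c, f} \<in> E"
    for a b c d e f
  proof -
    note no = no3[of a b c d e f] no3[of a e b f c d] no3[of a b c f d e] no3[of a e c f b d]
    have out: "{e, f} \<notin> E" "{b, f} \<notin> E" "{d, e} \<notin> E" "{b, d} \<notin> E"
      using no dist ab cd ae cf unfolding matching_def N by (auto simp: insert_commute)
    define m1 m2 where "m1 = (if {b, e} \<in> E then (b, e) else (a, b))"
      and "m2 = (if {d, f} \<in> E then (d, f) else (c, d))"
    have "matching (nbr v) [m1, m2]"
      using dist ab cd unfolding matching_def N m1_def m2_def by auto
    then obtain p q where "p \<in> nbr v" "q \<in> nbr v" "{p, q} \<in> E" "p \<notin> set [a, c]" "q \<notin> set [a, c]"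
      "(p, q) \<notin> set [m1, m2]" "(q, p) \<notin> set [m1, m2]"
      using link_not_weak_Koenig_Egervary[OF ne, of "[m1, m2]" "[a, c]"] by auto
    then show False
      using out edge_neq[of p q] unfolding N m1_def m2_def
      by (auto simp: insert_commute split: if_splits)
  qed
  \<comment> \<open>Here \<open>e\<close> and \<open>f\<close> hang on the same vertex
    \<open>a\<close>. By \<open>main\<close> neither is joined to \<open>c\<close> or
    \<open>d\<close>, so only \<open>c d\<close> remains outside \<open>a\<close> and
    \<open>b\<close>, and it is matched.\<close>
  have star: False
    if N: "nbr v = {a, b, c, d, e, f}" and dist: "distinct [a, b, c, d, e, f]"
      and ab: "{a, b} \<in> E" and cd: "{c, d} \<in> E" and ae: "{a, e} \<in> E" and af: "{a, f} \<in> E"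
    for a b c d e f
  proof -
    note no = no3[of a b c d e f] no3[of a e b f c d] no3[of a f b e c d]
    have out: "{e, f} \<notin> E" "{b, f} \<notin> E" "{b, e} \<notin> E"
      using no dist ab cd ae af unfolding matching_def N by (auto simp: insert_commute)
    have out2: "{e, c} \<notin> E" "{e, d} \<notin> E" "{f, c} \<notin> E" "{f, d} \<notin> E"
      using main[of a b c d e f] main[of a b d c e f] main[of a b c d f e] main[of a b d c f e]
        N dist ab cd ae af by (auto simp: insert_commute)
    have "matching (nbr v) [(a, e), (c, d)]"
      using dist ae cd unfolding matching_def N by auto
    then obtain p q where "p \<in> nbr v" "q \<in> nbr v" "{p, q} \<in> E" "p \<notin> set [a, b]" "q \<notin> set [a, b]"
      "(p, q) \<notin> set [(a, e), (c, d)]" "(q, p) \<notin> set [(a, e), (c, d)]"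
      using link_not_weak_Koenig_Egervary[OF ne, of "[(a, e), (c, d)]" "[a, b]"] by auto
    then show False
      using out out2 edge_neq[of p q] unfolding N by (auto simp: insert_commute)
  qed
  have touch: "\<exists>g\<in>{a, b, c, d}. {g, x} \<in> E" if "x \<in> {e, f}" for x
  proof -
    have "{v, x} \<in> E" using that N by (auto simp: nbr_def)
    then obtain g where "g \<in> nbr v" "g \<in> nbr x" using edge_in_triangle by blast
    moreover have "{e, f} \<notin> E"
      using no3[of a b c d e f] dist abcd unfolding matching_def N by auto
    ultimately show ?thesis
      using that edge_neq[of x g] unfolding N by (auto simp: nbr_def insert_commute)
  qed
  \<comment> \<open>With \<open>e\<close> attached to \<open>a\<close>, an edge \<open>b f\<close>
    would give the perfect matching \<open>a e\<close>, \<open>b f\<close>, \<open>c d\<close>; the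
    other positions of \<open>f\<close> fall under \<open>star\<close> and
    \<open>main\<close>.\<close>
  have same: False
    if N: "nbr v = {a, b, c, d, e, f}" and dist: "distinct [a, b, c, d, e, f]"
      and ab: "{a, b} \<in> E" and cd: "{c, d} \<in> E" and ae: "{a, e} \<in> E"
      and f: "\<exists>g\<in>{a, b, c, d}. {g, f} \<in> E"
    for a b c d e f
  proof -
    have "{b, f} \<notin> E"
      using no3[of a e b f c d] dist ab cd ae unfolding matching_def N by auto
    then have "{a, f} \<in> E \<or> {c, f} \<in> E \<or> {d, f} \<in> E" using f by blast
    then show False
      using main[of a b c d e f] main[of a b d c e f] star[of a b c d e f] N dist ab cd ae
      by (auto simp: insert_commute)
  qed
  obtain g where "g \<in> {a, b, c, d}" "{g, e} \<in> E" using touch by blast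
  then show False
    using same[of a b c d e f] same[of b a c d e f] same[of c d a b e f] same[of d c a b e f]
      N dist abcd touch[of f] by (auto simp: insert_commute)
qed

lemma finite_vertices: "finite (\<Union>E)"
  using finite_edges card_edge by (metis card.infinite finite_Union zero_neq_numeral)

lemma finite_nbr: "finite (nbr v)"
  using finite_vertices by (rule rev_finite_subset) (auto simp: nbr_def)

text \<open>Two disjoint link edges exhaust a link with at most four vertices. Both ends of the
  first as \<open>Q\<close> leave only the second, which is matched.\<close>

lemma degree_ge_5:
  assumes "nbr v \<noteq> {}"
  shows "5 \<le> card (nbr v)"
proof (rule ccontr)
  assume "\<not> 5 \<le> card (nbr v)"
  then have le: "card (nbr v) \<le> 4" by simp
  obtain a b c d where M: "matching (nbr v) [(a, b), (c, d)]"
    using link_matching_2[OF assms] .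
  then have abcd: "distinct [a, b, c, d]" "{a, b, c, d} \<subseteq> nbr v"
    by (auto simp: matching_def)
  then have N: "nbr v = {a, b, c, d}"
    using le by (intro card_seteq[symmetric] finite_nbr) auto
  obtain p q where "p \<in> nbr v" "q \<in> nbr v" "{p, q} \<in> E" "p \<notin> set [a, b]" "q \<notin> set [a, b]"
    "(p, q) \<notin> set [(a, b), (c, d)]" "(q, p) \<notin> set [(a, b), (c, d)]"
    using link_not_weak_Koenig_Egervary[OF assms M, of "[a, b]"] by auto
  then show False
    using edge_neq[of p q] N by auto
qed

text \<open>If \<open>y\<close> misses \<open>x\<close> and \<open>z\<close>, then the other two
  link vertices as \<open>Q\<close> leave at most the edge \<open>x z\<close>. When that edge
  exists, it joins an edge at \<open>y\<close> in a matching of size 2.\<close>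

lemma co_matching_link_5:
  assumes card5: "card (nbr v) = 5"
  shows "co_matching (nbr v)"
  unfolding co_matching_def
proof (intro ballI impI, rule ccontr)
  fix y x z
  assume xyz: "y \<in> nbr v" "x \<in> nbr v" "z \<in> nbr v" "y \<noteq> x" "y \<noteq> z" "x \<noteq> z"
    and no: "\<not> ({y, x} \<in> E \<or> {y, z} \<in> E)"
  have ne: "nbr v \<noteq> {}" using xyz by blast
  have "card (nbr v - {x, y, z}) = 2"
    using xyz card5 by (subst card_Diff_subset) auto
  then obtain p q where pq: "nbr v - {x, y, z} = {p, q}" "p \<noteq> q"
    by (auto simp: card_2_iff)
  have N: "nbr v = {x, y, z, p, q}" using pq xyz by auto
  have "\<exists>M. matching (nbr v) M \<and> length M = 2 \<and> ({x, z} \<in> E \<longrightarrow> (x, z) \<in> set M)"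
  proof (cases "{x, z} \<in> E")
    case True
    obtain w where w: "w \<in> nbr v" "w \<in> nbr y"
      using edge_in_triangle[of v y] xyz by (auto simp: nbr_def)
    then have "w \<noteq> x" "w \<noteq> z" "w \<noteq> y"
      using no nbr_irrefl by (auto simp: nbr_def)
    then have "matching (nbr v) [(x, z), (y, w)]"
      using xyz w True by (auto simp: matching_def nbr_def)
    then show ?thesis by (intro exI[of _ "[(x, z), (y, w)]"]) auto
  next
    case False
    then show ?thesis using link_matching_2[OF ne] by (metis length_Cons list.size(3) numeral_2_eq_2)
  qed
  then obtain M where M: "matching (nbr v) M" "length M = 2" "{x, z} \<in> E \<longrightarrow> (x, z) \<in> set M"
    by blast
  obtain r s where "r \<in> nbr v" "s \<in> nbr v" "{r, s} \<in> E" "r \<notin> set [p, q]" "s \<notin> set [p, q]"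
    "(r, s) \<notin> set M" "(s, r) \<notin> set M"
    using link_not_weak_Koenig_Egervary[OF ne M(1), of "[p, q]"] M(2) by auto
  then show False
    using M(3) no N edge_neq[of r s] by (auto simp: insert_commute)
qed

text \<open>For a perfect matching \<open>M\<close> of the link, every triple spans an edge outside
  \<open>M\<close> (\<open>triple\<close>, with the other three vertices as \<open>Q\<close>). If
  \<open>y\<close> missed \<open>x\<close> and \<open>z\<close>, then \<open>x z\<close> would be an
  edge in no perfect matching, so \<open>x\<close>, \<open>y\<close>, \<open>z\<close> would be
  matched to the other three vertices; these turn out to be independent, against
  \<open>triple\<close>.\<close>

lemma co_matching_link_6:
  assumes card6: "card (nbr v) = 6"
  shows "co_matching (nbr v)"
  unfolding co_matching_def
proof (intro ballI impI, rule ccontr)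
  fix y x z
  assume xyz: "y \<in> nbr v" "x \<in> nbr v" "z \<in> nbr v" "y \<noteq> x" "y \<noteq> z" "x \<noteq> z"
    and no: "\<not> ({y, x} \<in> E \<or> {y, z} \<in> E)"
  have ne: "nbr v \<noteq> {}" using xyz by blast
  have triple: "({r, s} \<in> E \<and> (r, s) \<notin> set M \<and> (s, r) \<notin> set M) \<or>
      ({r, t} \<in> E \<and> (r, t) \<notin> set M \<and> (t, r) \<notin> set M) \<or>
      ({s, t} \<in> E \<and> (s, t) \<notin> set M \<and> (t, s) \<notin> set M)"
    if M: "matching (nbr v) M" "length M = 3"
      and rst: "{r, s, t} \<subseteq> nbr v" "distinct [r, s, t]" for M r s t
  proof -
    have "card (nbr v - {r, s, t}) = 3"
      using rst card6 by (subst card_Diff_subset) auto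
    then obtain Q where Q: "set Q = nbr v - {r, s, t}" "length Q = 3"
      by (metis distinct_card finite_Diff finite_distinct_list finite_nbr)
    have "length Q \<le> length M" using M(2) Q(2) by simp
    from link_not_weak_Koenig_Egervary[OF ne M(1) this]
    obtain p q where pq: "p \<in> nbr v" "q \<in> nbr v" "{p, q} \<in> E" "p \<notin> set Q" "q \<notin> set Q"
      "(p, q) \<notin> set M" "(q, p) \<notin> set M" .
    then have "p \<in> {r, s, t}" "q \<in> {r, s, t}" "p \<noteq> q"
      using edge_neq[of p q] Q(1) by blast+
    then show ?thesis
      using pq(3,6,7) by (elim insertE emptyE) (simp_all add: insert_commute)
  qed
  obtain a b c d e f where M0: "matching (nbr v) [(a, b), (c, d), (e, f)]"
    using link_matching_3[OF card6] .
  have xz: "{x, z} \<in> E"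
    using triple[OF M0, of x y z] no xyz by (auto simp: insert_commute)
  have xzM: "\<not> matching (nbr v) [(x, z), (r, s), (t, u)]" for r s t u
    using triple[of "[(x, z), (r, s), (t, u)]" x y z] no xyz by (auto simp: insert_commute)
  have "\<exists>p q r. matching (nbr v) [(y, p), (x, q), (z, r)]"
  proof -
    have N: "nbr v = {a, b, c, d, e, f}"
    proof (rule card_seteq[symmetric, OF finite_nbr])
      show "{a, b, c, d, e, f} \<subseteq> nbr v" using M0 by (auto simp: matching_def)
      show "card (nbr v) \<le> card {a, b, c, d, e, f}" using M0 card6 by (auto simp: matching_def)
    qed
    define P where "P s t \<longleftrightarrow> {(s, t), (t, s)} \<inter> {(a, b), (c, d), (e, f)} \<noteq> {}" for s t
    have ex: "\<exists>t. P s t" if "s \<in> nbr v" for s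
      using that N by (auto simp: P_def)
    have P: "s \<in> nbr v" "t \<in> nbr v" "{s, t} \<in> E" if "P s t" for s t
      using that M0 by (auto simp: P_def matching_def insert_commute)
    have inj: "s = s'" if "P s t" "P s' t" for s s' t
      using that M0 by (auto simp: P_def matching_def)
    have psym: "P t s" if "P s t" for s t using that by (auto simp: P_def)
    obtain p q r where pqr: "P y p" "P x q" "P z r" using ex xyz by meson
    have xz': "\<not> P x z"
      using triple[OF M0, of x y z] no xyz by (auto simp: P_def insert_commute)
    have "p \<noteq> x" "p \<noteq> z" "q \<noteq> y" "r \<noteq> y"
      using no P(3)[OF pqr(1)] P(3)[OF pqr(2)] P(3)[OF pqr(3)] by (auto simp: insert_commute)
    moreover have "q \<noteq> z" "r \<noteq> x" using xz' pqr psym by auto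
    moreover have "p \<noteq> q" "p \<noteq> r" "q \<noteq> r" using inj pqr xyz by metis+
    moreover have "p \<noteq> y" "q \<noteq> x" "r \<noteq> z" using P(3) pqr edge_neq by metis+
    ultimately show ?thesis
      using pqr P xyz by (intro exI[of _ p] exI[of _ q] exI[of _ r]) (auto simp: matching_def)
  qed
  then obtain p q r where M: "matching (nbr v) [(y, p), (x, q), (z, r)]" by blast
  then have d: "distinct [x, y, z, p, q, r]" and N: "{x, y, z, p, q, r} \<subseteq> nbr v"
    and E: "{y, p} \<in> E" "{x, q} \<in> E" "{z, r} \<in> E" by (auto simp: matching_def)
  note tr = triple[OF M]
  \<comment> \<open>Of the triple \<open>y\<close>, \<open>x\<close>, \<open>q\<close>, the pair
    \<open>y x\<close> is a non-edge and \<open>x q\<close> is matched, so \<open>y q\<close> is the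
    edge that \<open>triple\<close> demands.\<close>
  have yq: "{y, q} \<in> E" using tr[of y x q] no d N by (auto simp: insert_commute)
  have yr: "{y, r} \<in> E" using tr[of y z r] no d N by (auto simp: insert_commute)
  \<comment> \<open>Each of these edges would complete a perfect matching containing
    \<open>x z\<close>.\<close>
  have "{p, q} \<notin> E" "{p, r} \<notin> E" "{q, r} \<notin> E"
    using xzM[of y r p q] xzM[of y q p r] xzM[of y p q r] d N E xz yq yr
    by (auto simp: matching_def)
  then show False using tr[of p q r] d N by auto
qed

lemma low_link:
  assumes "nbr v \<noteq> {}" "card (nbr v) \<le> 6"
  shows "card (nbr v) = 5 \<or> card (nbr v) = 6" "co_matching (nbr v)"
proof -
  show "card (nbr v) = 5 \<or> card (nbr v) = 6"
    using degree_ge_5[OF assms(1)] assms(2) by linarith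
  then show "co_matching (nbr v)"
    using co_matching_link_5 co_matching_link_6 by blast
qed

section \<open>Labelling sets that are complete up to a matching\<close>

lemma co_matching_subset: "co_matching C \<Longrightarrow> D \<subseteq> C \<Longrightarrow> co_matching D"
  unfolding co_matching_def by blast

text \<open>The pair is a non-adjacent one if there is any, and arbitrary otherwise; whether
  \<open>{a, b}\<close> is an edge stays open. Splitting off such pairs labels sets of size 3 to
  5.\<close>

lemma co_matching_pair:
  assumes "co_matching C" "2 \<le> card C"
  obtains a b where "a \<in> C" "b \<in> C" "a \<noteq> b" "\<And>x. x \<in> C - {a, b} \<Longrightarrow> {a, x} \<in> E \<and> {b, x} \<in> E"
proof (cases "\<exists>a\<in>C. \<exists>b\<in>C. a \<noteq> b \<and> {a, b} \<notin> E")
  case True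
  then obtain a b where ab: "a \<in> C" "b \<in> C" "a \<noteq> b" "{a, b} \<notin> E" by blast
  show ?thesis
  proof (rule that[OF ab(1-3)])
    fix x assume "x \<in> C - {a, b}"
    then show "{a, x} \<in> E \<and> {b, x} \<in> E"
      using assms(1)[unfolded co_matching_def, rule_format, of a b x]
        assms(1)[unfolded co_matching_def, rule_format, of b a x] ab
      by (auto simp: insert_commute)
  qed
next
  case False
  obtain D where "D \<subseteq> C" "card D = 2" using assms(2) obtain_subset_with_card_n by metis
  then obtain a b where ab: "a \<in> C" "b \<in> C" "a \<noteq> b" by (auto simp: card_2_iff)
  show ?thesis
  proof (rule that[OF ab])
    fix x assume "x \<in> C - {a, b}"
    then show "{a, x} \<in> E \<and> {b, x} \<in> E" using False ab by auto
  qed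
qed

lemma co_matching_3:
  assumes "co_matching C" "card C = 3"
  obtains a b c where "C = {a, b, c}" "distinct [a, b, c]" "set [{a, c}, {b, c}] \<subseteq> E"
proof -
  obtain a b where ab: "a \<in> C" "b \<in> C" "a \<noteq> b"
    "\<And>x. x \<in> C - {a, b} \<Longrightarrow> {a, x} \<in> E \<and> {b, x} \<in> E"
    using co_matching_pair[OF assms(1)] assms(2) by auto
  have "card (C - {a, b}) = 1" using ab assms(2) by (subst card_Diff_subset) auto
  then obtain c where c: "C - {a, b} = {c}" by (auto simp: card_1_singleton_iff)
  show ?thesis by (rule that[of a b c]) (use ab c in auto)
qed

lemma co_matching_4:
  assumes "co_matching C" "card C = 4"
  obtains a b c d where "C = {a, b, c, d}" "distinct [a, b, c, d]"
    "set [{a, c}, {a, d}, {b, c}, {b, d}] \<subseteq> E"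
proof -
  obtain a b where ab: "a \<in> C" "b \<in> C" "a \<noteq> b"
    "\<And>x. x \<in> C - {a, b} \<Longrightarrow> {a, x} \<in> E \<and> {b, x} \<in> E"
    using co_matching_pair[OF assms(1)] assms(2) by auto
  have "card (C - {a, b}) = 2" using ab assms(2) by (subst card_Diff_subset) auto
  then obtain c d where c: "C - {a, b} = {c, d}" "c \<noteq> d" by (auto simp: card_2_iff)
  show ?thesis by (rule that[of a b c d]) (use ab c in auto)
qed

lemma co_matching_5:
  assumes "co_matching C" "card C = 5"
  obtains a b c d e where "C = {a, b, c, d, e}" "distinct [a, b, c, d, e]"
    "set [{a, c}, {a, d}, {b, c}, {b, d}, {a, e}, {b, e}, {c, e}, {d, e}] \<subseteq> E"
proof -
  obtain a b where ab: "a \<in> C" "b \<in> C" "a \<noteq> b"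
    "\<And>x. x \<in> C - {a, b} \<Longrightarrow> {a, x} \<in> E \<and> {b, x} \<in> E"
    using co_matching_pair[OF assms(1)] assms(2) by auto
  have "card (C - {a, b}) = 3" using ab assms(2) by (subst card_Diff_subset) auto
  moreover have "co_matching (C - {a, b})" using assms(1) by (rule co_matching_subset) auto
  ultimately obtain c d e where c: "C - {a, b} = {c, d, e}" "distinct [c, d, e]"
    "set [{c, e}, {d, e}] \<subseteq> E"
    using co_matching_3 by metis
  show ?thesis by (rule that[of a b c d e]) (use ab c in auto)
qed

text \<open>
  In the configurations below, \<open>u\<close> and \<open>v\<close> are deleted, and pairs of the remaining vertices that
  are not assumed to be edges may or may not be edges: the packing avoids them, the cover
  contains them where they matter. Packings and covers were found by computer search.
\<close>

lemma singleton_notin_E: "{v} \<notin> E"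
  using card_edge by fastforce

lemma spokes: "\<forall>w\<in>nbr v. {v, w} \<in> E"
  by (simp add: nbr_def)

section \<open>Reducible pairs of vertices of degree 5 or 6\<close>

lemma no_adjacent_6_6_twins:
  assumes nbr: "nbr u = {v, a, b, c, d, e}" "nbr v = {u, a, b, c, d, e}"
    and dist: "distinct [u, v, a, b, c, d, e]"
    and edges: "set [{a, c}, {a, d}, {b, c}, {b, d}, {a, e}, {b, e}, {c, e}, {d, e}] \<subseteq> E"
  shows False
proof (rule reducible[of "{u, v}"
      "[(a, e, d), (a, u, v), (b, e, v), (b, d, u), (c, e, u)]"
      "[{a, b}, {a, e}, {a, d}, {b, e}, {b, d}, {c, e}, {c, u}, {c, v}, {e, d}, {u, v}]"],
    goal_cases)
  case 1
  show ?case using spokes[of u] unfolding nbr by auto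
next
  case 2
  have "distinct [e, d, c, b, a, v, u]" using dist by auto
  with dist show ?case by (simp add: doubleton_eq_iff)
next
  case 3
  show ?case using edges spokes[of u] spokes[of v] unfolding nbr by (simp add: insert_commute)
next
  case 5
  show ?case by (simp add: insert_commute)
next
  case 6
  show ?case by (simp add: nbr singleton_notin_E insert_commute)
qed simp

lemma no_adjacent_6_6:
  assumes nbr: "nbr u = {v, a, b, c, d, x}" "nbr v = {u, a, b, c, d, y}"
    and dist: "distinct [u, v, a, b, c, d, x, y]"
    and edges: "set [{a, c}, {a, d}, {b, c}, {b, d}, {x, a}, {x, b}, {x, c}, {x, d},
      {y, a}, {y, b}, {y, c}, {y, d}] \<subseteq> E"
  shows False
proof (rule reducible[of "{u, v}"
      "[(a, c, y), (a, d, v), (a, u, x), (b, d, u), (b, v, y), (c, u, v)]"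
      "[{a, c}, {a, d}, {a, u}, {a, x}, {a, y}, {b, d}, {b, v}, {b, y}, {c, u}, {c, y}, {d, v}, {u, x}]"],
    goal_cases)
  case 1
  show ?case using spokes[of u] unfolding nbr by auto
next
  case 2
  have "distinct [y, x, d, c, b, a, v, u]" using dist by auto
  with dist show ?case by (simp add: doubleton_eq_iff)
next
  case 3
  show ?case using edges spokes[of u] spokes[of v] unfolding nbr by (simp add: insert_commute)
next
  case 5
  show ?case by (simp add: insert_commute)
next
  case 6
  \<comment> \<open>The cover contains neither \<open>{u, v}\<close> nor \<open>{v, y}\<close>;
    there is no triangle \<open>u v y\<close> because \<open>u\<close> and \<open>y\<close> are not
    adjacent.\<close>
  have "y \<notin> nbr u" "x \<notin> nbr v" using nbr dist by auto
  then have "{u, y} \<notin> E" "{v, x} \<notin> E" by (simp_all add: nbr_def)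
  then show ?case by (simp add: nbr singleton_notin_E insert_commute)
qed simp

lemma no_adjacent_6_5:
  assumes nbr: "nbr u = {v, a, b, c, d, x}" "nbr v = {u, a, b, c, d}"
    and dist: "distinct [u, v, a, b, c, d, x]"
    and edges: "set [{a, c}, {a, d}, {b, c}, {b, d}] \<subseteq> E"
  shows False
proof (rule reducible[of "{u, v}"
      "[(a, c, v), (a, d, u), (b, c, u), (b, d, v)]"
      "[{a, b}, {a, c}, {a, d}, {b, c}, {b, d}, {c, d}, {u, v}, {u, x}]"],
    goal_cases)
  case 1
  show ?case using spokes[of u] unfolding nbr by auto
next
  case 2
  have "distinct [x, d, c, b, a, v, u]" using dist by auto
  with dist show ?case by (simp add: doubleton_eq_iff)
next
  case 3
  show ?case using edges spokes[of u] spokes[of v] unfolding nbr by (simp add: insert_commute)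
next
  case 5
  show ?case by (simp add: insert_commute)
next
  case 6
  show ?case by (simp add: nbr singleton_notin_E insert_commute)
qed simp

lemma no_adjacent_5_5_twins:
  assumes nbr: "nbr u = {v, a, b, c, d}" "nbr v = {u, a, b, c, d}"
    and dist: "distinct [u, v, a, b, c, d]"
    and edges: "set [{a, c}, {a, d}, {b, c}, {b, d}] \<subseteq> E"
  shows False
proof (rule reducible[of "{u, v}"
      "[(a, c, v), (b, c, u), (d, u, v)]"
      "[{a, b}, {a, c}, {b, c}, {d, u}, {d, v}, {u, v}]"],
    goal_cases)
  case 1
  show ?case using spokes[of u] unfolding nbr by auto
next
  case 2
  have "distinct [d, c, b, a, v, u]" using dist by auto
  with dist show ?case by (simp add: doubleton_eq_iff)
next
  case 3
  show ?case using edges spokes[of u] spokes[of v] unfolding nbr by (simp add: insert_commute)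
next
  case 5
  show ?case by (simp add: insert_commute)
next
  case 6
  show ?case by (simp add: nbr singleton_notin_E insert_commute)
qed simp

lemma no_adjacent_5_5:
  assumes nbr: "nbr u = {v, a, b, c, x}" "nbr v = {u, a, b, c, y}"
    and dist: "distinct [u, v, a, b, c, x, y]"
    and edges: "set [{a, c}, {b, c}, {x, a}, {x, b}, {x, c}, {y, a}, {y, b}, {y, c}] \<subseteq> E"
  shows False
proof (rule reducible[of "{u, v}"
      "[(a, c, x), (a, v, y), (b, c, y), (b, u, x), (c, u, v)]"
      "[{a, b}, {a, c}, {a, x}, {a, y}, {b, c}, {b, x}, {b, y}, {c, x}, {c, y}, {u, v}]"],
    goal_cases)
  case 1
  show ?case using spokes[of u] unfolding nbr by auto
next
  case 2
  have "distinct [y, x, c, b, a, v, u]" using dist by auto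
  with dist show ?case by (simp add: doubleton_eq_iff)
next
  case 3
  show ?case using edges spokes[of u] spokes[of v] unfolding nbr by (simp add: insert_commute)
next
  case 5
  show ?case by (simp add: insert_commute)
next
  case 6
  show ?case by (simp add: nbr singleton_notin_E insert_commute)
qed simp

text \<open>Here and in \<open>no_5_5_common_4\<close> the two deleted vertices are not adjacent;
  \<open>a\<close> will be their common neighbour of degree 7.\<close>

lemma no_5_5_twins:
  assumes nbr: "nbr u = {a, b, c, d, z}" "nbr v = {a, b, c, d, z}"
    and dist: "distinct [u, v, a, b, c, d, z]"
    and edges: "set [{b, d}, {c, d}, {z, b}, {z, c}, {z, d}] \<subseteq> E"
  shows False
proof (rule reducible[of "{u, v}"
      "[(b, d, v), (b, z, u), (c, d, u), (c, z, v)]"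
      "[{a, u}, {a, v}, {b, c}, {b, d}, {b, z}, {c, d}, {c, z}, {d, z}]"],
    goal_cases)
  case 1
  show ?case using spokes[of u] unfolding nbr by auto
next
  case 2
  have "distinct [z, d, c, b, a, v, u]" using dist by auto
  with dist show ?case by (simp add: doubleton_eq_iff)
next
  case 3
  show ?case using edges spokes[of u] spokes[of v] unfolding nbr by (simp add: insert_commute)
next
  case 5
  show ?case by (simp add: insert_commute)
next
  case 6
  show ?case by (simp add: nbr singleton_notin_E insert_commute)
qed simp

lemma no_5_5_common_4:
  assumes nbr: "nbr u = {a, b, c, d, y}" "nbr v = {a, b, c, d, z}"
    and dist: "distinct [u, v, a, b, c, d, y, z]"
    and edges: "set [{a, b}, {a, c}, {a, d}, {b, d}, {c, d}, {z, b}, {z, c}, {z, d}] \<subseteq> E"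
    and "{a, z} \<notin> E"
  shows False
proof (rule reducible[of "{u, v}"
      "[(a, c, u), (a, d, v), (b, d, u), (b, z, v), (c, d, z)]"
      "[{a, c}, {a, d}, {b, d}, {b, z}, {b, u}, {b, v}, {c, d}, {c, z}, {d, z}, {y, u}]"],
    goal_cases)
  case 1
  show ?case using spokes[of u] unfolding nbr by auto
next
  case 2
  have "distinct [z, y, d, c, b, a, v, u]" using dist by auto
  with dist show ?case by (simp add: doubleton_eq_iff)
next
  case 3
  show ?case using edges spokes[of u] spokes[of v] unfolding nbr by (simp add: insert_commute)
next
  case 5
  show ?case by (simp add: insert_commute)
next
  case 6
  \<comment> \<open>The cover misses all three sides of \<open>v a z\<close>, which is no triangle
    because \<open>{a, z}\<close> is not an edge.\<close>
  show ?case using assms(5) by (simp add: nbr singleton_notin_E insert_commute)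
qed simp

section \<open>Independence of the vertices of degree at most 6\<close>

text \<open>The largest integer below 25/4 is 6. Nonemptiness excludes elements of the type that lie
  on no edge.\<close>

definition low :: "'a \<Rightarrow> bool" where
  "low v \<longleftrightarrow> nbr v \<noteq> {} \<and> card (nbr v) \<le> 6"

text \<open>In the link of \<open>u\<close> each vertex has at most one non-neighbour, and
  \<open>v\<close> and \<open>x\<close> are each other's.\<close>

lemma low_nonadjacent_unique:
  assumes "low u" "v \<in> nbr u" "x \<in> nbr u" "x \<notin> nbr v" "x \<noteq> v"
  shows "nbr u - {v, x} \<subseteq> nbr v \<inter> nbr x"
proof -
  have "co_matching (nbr u)" using low_link assms(1) by (simp add: low_def)
  note cm = this[unfolded co_matching_def, rule_format]
  show ?thesis
  proof
    fix w assume "w \<in> nbr u - {v, x}"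
    then show "w \<in> nbr v \<inter> nbr x"
      using cm[of v x w] cm[of x v w] assms by (auto simp: nbr_def insert_commute)
  qed
qed

lemma card_common_nbr:
  assumes "low u" "v \<in> nbr u"
  shows "card (nbr u) \<le> card (nbr u \<inter> nbr v) + 2"
proof (cases "nbr u - {v} \<subseteq> nbr v")
  case True
  then have "nbr u \<subseteq> insert v (nbr u \<inter> nbr v)" by blast
  then have "card (nbr u) \<le> card (insert v (nbr u \<inter> nbr v))"
    by (intro card_mono) (auto simp: finite_nbr)
  then show ?thesis
    using card_insert_le_m1[of "card (nbr u \<inter> nbr v) + 1" "nbr u \<inter> nbr v" v] by linarith
next
  case False
  then obtain x where x: "x \<in> nbr u" "x \<noteq> v" "x \<notin> nbr v" by blast
  then have "nbr u \<subseteq> insert v (insert x (nbr u \<inter> nbr v))"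
    using low_nonadjacent_unique[OF assms x(1,3,2)] by blast
  then have "card (nbr u) \<le> card (insert v (insert x (nbr u \<inter> nbr v)))"
    by (intro card_mono) (auto simp: finite_nbr)
  also have "\<dots> \<le> Suc (Suc (card (nbr u \<inter> nbr v)))"
    by (simp add: card_insert_if finite_nbr)
  finally show ?thesis by simp
qed

text \<open>If \<open>v\<close> sees all other neighbours of \<open>u\<close>, the two are twins of
  equal degree. Otherwise \<open>v\<close> misses exactly one neighbour \<open>x\<close> of
  \<open>u\<close>, the set \<open>C\<close> of the remaining ones is common to both, and
  \<open>v\<close> has one further neighbour \<open>y\<close> or none. Degrees 5 and 6 leave five
  configurations, all reducible.\<close>

lemma adjacent_low_degree_le:
  assumes "low u" "low v" "v \<in> nbr u" "card (nbr v) \<le> card (nbr u)"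
  shows False
proof -
  have uv: "u \<in> nbr v" using assms(3) nbr_sym by blast
  have ne: "u \<noteq> v" using assms(3) nbr_irrefl by blast
  have lu: "card (nbr u) = 5 \<or> card (nbr u) = 6" "co_matching (nbr u)"
    using low_link assms(1) by (auto simp: low_def)
  have lv: "card (nbr v) = 5 \<or> card (nbr v) = 6" using low_link assms(2) by (auto simp: low_def)
  have cards: "card (nbr u - {v}) = card (nbr u) - 1" "card (nbr v - {u}) = card (nbr v) - 1"
    using assms(3) uv by auto
  show False
  proof (cases "nbr u - {v} \<subseteq> nbr v")
    case True
    then have "nbr u - {v} \<subseteq> nbr v - {u}" using nbr_irrefl by blast
    then have eq: "nbr u - {v} = nbr v - {u}"
      by (rule card_seteq[rotated]) (use cards assms(4) in \<open>auto simp: finite_nbr\<close>)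
    have cm: "co_matching (nbr u - {v})" using lu(2) by (rule co_matching_subset) auto
    from lu(1) show False
    proof
      assume "card (nbr u) = 6"
      then have "card (nbr u - {v}) = 5" using cards by simp
      from co_matching_5[OF cm this] obtain a b c d e where *:
        "nbr u - {v} = {a, b, c, d, e}" "distinct [a, b, c, d, e]"
        "set [{a, c}, {a, d}, {b, c}, {b, d}, {a, e}, {b, e}, {c, e}, {d, e}] \<subseteq> E" .
      have "nbr u = {v, a, b, c, d, e}" "nbr v = {u, a, b, c, d, e}"
        using *(1) eq assms(3) uv by auto
      moreover have "distinct [u, v, a, b, c, d, e]"
        using * ne eq by auto
      ultimately show False using no_adjacent_6_6_twins *(3) by blast
    next
      assume "card (nbr u) = 5"
      then have "card (nbr u - {v}) = 4" using cards by simp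
      from co_matching_4[OF cm this] obtain a b c d where *:
        "nbr u - {v} = {a, b, c, d}" "distinct [a, b, c, d]"
        "set [{a, c}, {a, d}, {b, c}, {b, d}] \<subseteq> E" .
      have "nbr u = {v, a, b, c, d}" "nbr v = {u, a, b, c, d}"
        using *(1) eq assms(3) uv by auto
      moreover have "distinct [u, v, a, b, c, d]"
        using * ne eq by auto
      ultimately show False using no_adjacent_5_5_twins *(3) by blast
    qed
  next
    case False
    then obtain x where x: "x \<in> nbr u" "x \<notin> nbr v" "x \<noteq> v" by blast
    define C where "C = nbr u - {v, x}"
    have Cv: "C \<subseteq> nbr v" and Cx: "C \<subseteq> nbr x"
      using low_nonadjacent_unique[OF assms(1,3) x] by (auto simp: C_def)
    have Nu: "nbr u = insert v (insert x C)" using x assms(3) by (auto simp: C_def)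
    have cC: "card C = card (nbr u) - 2"
      unfolding C_def using x assms(3) by (subst card_Diff_subset) auto
    have uC: "u \<notin> C" "v \<notin> C" "x \<notin> C" "u \<noteq> x" using nbr_irrefl x by (auto simp: C_def)
    have cm: "co_matching C" using lu(2) by (rule co_matching_subset) (auto simp: C_def)
    have sub: "insert u C \<subseteq> nbr v" using Cv uv by auto
    have fC: "finite C" by (simp add: C_def finite_nbr)
    have cuC: "card (insert u C) = card (nbr u) - 1" using uC fC cC lu(1) by auto
    show False
    proof (cases "card (nbr v) = card (nbr u)")
      case True
      then have "card (nbr v - insert u C) = 1"
        using sub cuC fC lu(1) by (subst card_Diff_subset) auto
      then obtain y where y: "nbr v - insert u C = {y}" by (auto simp: card_1_singleton_iff)
      have Nv: "nbr v = insert u (insert y C)" using y sub by auto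
      have yC: "y \<notin> C" "y \<noteq> u" using y by auto
      have yv: "y \<noteq> v" using y nbr_irrefl by auto
      have yx: "y \<noteq> x" using y x by auto
      have yu: "y \<notin> nbr u" using Nu yC yv yx by auto
      \<comment> \<open>Inside \<open>nbr v\<close>, the vertices \<open>u\<close> and
        \<open>y\<close> are each other's only non-neighbour.\<close>
      have Cy: "C \<subseteq> nbr y"
        using low_nonadjacent_unique[OF assms(2) uv _ yu] y yC uC by (auto simp: Nv)
      from lu(1) show False
      proof
        assume "card (nbr u) = 6"
        then have "card C = 4" using cC by simp
        from co_matching_4[OF cm this] obtain a b c d where *:
          "C = {a, b, c, d}" "distinct [a, b, c, d]"
          "set [{a, c}, {a, d}, {b, c}, {b, d}] \<subseteq> E" .
        have "nbr u = {v, a, b, c, d, x}" "nbr v = {u, a, b, c, d, y}"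
          using Nu Nv * by auto
        moreover have "distinct [u, v, a, b, c, d, x, y]"
          using * ne uC yC yv yx x by auto
        moreover have "set [{a, c}, {a, d}, {b, c}, {b, d}, {x, a}, {x, b}, {x, c}, {x, d},
            {y, a}, {y, b}, {y, c}, {y, d}] \<subseteq> E"
          using *(1,3) Cx Cy by (simp add: nbr_def)
        ultimately show False using no_adjacent_6_6 by blast
      next
        assume "card (nbr u) = 5"
        then have "card C = 3" using cC by simp
        from co_matching_3[OF cm this] obtain a b c where *:
          "C = {a, b, c}" "distinct [a, b, c]" "set [{a, c}, {b, c}] \<subseteq> E" .
        have "nbr u = {v, a, b, c, x}" "nbr v = {u, a, b, c, y}"
          using Nu Nv * by auto
        moreover have "distinct [u, v, a, b, c, x, y]"
          using * ne uC yC yv yx x by auto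
        moreover have "set [{a, c}, {b, c}, {x, a}, {x, b}, {x, c}, {y, a}, {y, b}, {y, c}] \<subseteq> E"
          using *(1,3) Cx Cy by (simp add: nbr_def)
        ultimately show False using no_adjacent_5_5 by blast
      qed
    next
      case False
      then have c: "card (nbr u) = 6" "card (nbr v) = 5" using lu(1) lv assms(4) by auto
      then have Nv: "nbr v = insert u C"
        using card_seteq[OF finite_nbr sub] cuC by simp
      have "card C = 4" using cC c by simp
      from co_matching_4[OF cm this] obtain a b c d where *:
        "C = {a, b, c, d}" "distinct [a, b, c, d]"
        "set [{a, c}, {a, d}, {b, c}, {b, d}] \<subseteq> E" .
      have "nbr u = {v, a, b, c, d, x}" "nbr v = {u, a, b, c, d}"
        using Nu Nv * by auto
      moreover have "distinct [u, v, a, b, c, d, x]"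
        using * ne uC x by auto
      ultimately show False using no_adjacent_6_5 *(3) by blast
    qed
  qed
qed

lemma low_independent:
  assumes "low u" "low v"
  shows "v \<notin> nbr u"
proof
  assume v: "v \<in> nbr u"
  then have u: "u \<in> nbr v" using nbr_sym[of u v] by simp
  show False
    using adjacent_low_degree_le[OF assms v] adjacent_low_degree_le[OF assms(2,1) u] by linarith
qed

section \<open>Low neighbours of vertices of degree at least 7\<close>

definition low_nbr :: "'a \<Rightarrow> 'a set" where
  "low_nbr v = {w \<in> nbr v. low w}"

lemma common_nbr_high:
  assumes "w \<in> low_nbr v"
  shows "nbr w \<inter> nbr v \<subseteq> nbr v - low_nbr v"
proof
  fix x assume x: "x \<in> nbr w \<inter> nbr v"
  then have "\<not> low x" using low_independent[of w x] assms by (auto simp: low_nbr_def)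
  then show "x \<in> nbr v - low_nbr v" using x by (simp add: low_nbr_def)
qed

text \<open>All but at most two neighbours of \<open>w\<close> are neighbours of \<open>v\<close>,
  and none of these is low since \<open>w\<close> is low.\<close>

lemma card_high_nbr:
  assumes "w \<in> low_nbr v"
  shows "card (nbr w) \<le> card (nbr v) - card (low_nbr v) + 2"
proof -
  have w: "low w" "v \<in> nbr w" using assms nbr_sym by (auto simp: low_nbr_def)
  have sub: "low_nbr v \<subseteq> nbr v" by (auto simp: low_nbr_def)
  have "card (nbr w \<inter> nbr v) \<le> card (nbr v - low_nbr v)"
    using common_nbr_high[OF assms] by (intro card_mono) (auto simp: finite_nbr)
  also have "\<dots> = card (nbr v) - card (low_nbr v)"
    using sub finite_subset[OF sub finite_nbr] by (simp add: card_Diff_subset)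
  finally show ?thesis using card_common_nbr[OF w] by linarith
qed

text \<open>Four low neighbours would leave a set \<open>H\<close> of at most three others. Each low
  neighbour then has degree exactly 5, its neighbours being \<open>v\<close>, all of
  \<open>H\<close> and one vertex \<open>z\<close> outside \<open>nbr v\<close>. Two of them form
  one of the non-adjacent configurations, according to whether their outside vertices
  coincide.\<close>

lemma card_low_nbr_7:
  assumes "card (nbr v) = 7"
  shows "card (low_nbr v) \<le> 3"
proof (rule ccontr)
  assume "\<not> card (low_nbr v) \<le> 3"
  then have k4: "4 \<le> card (low_nbr v)" by simp
  define H where "H = nbr v - low_nbr v"
  have sub: "low_nbr v \<subseteq> nbr v" by (auto simp: low_nbr_def)
  have fH: "finite H" by (simp add: H_def finite_nbr)
  have cH: "card H \<le> 3"
    using sub finite_subset[OF sub finite_nbr] k4 assms by (simp add: H_def card_Diff_subset)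
  have key: "card H = 3 \<and> (\<exists>z. nbr w = insert v (insert z H) \<and> z \<notin> H \<and> z \<noteq> v \<and> z \<notin> nbr v \<and>
      H \<subseteq> nbr z) \<and> co_matching H \<and> H \<subseteq> nbr v \<and> v \<notin> H"
    if w: "w \<in> low_nbr v" for w
  proof -
    have lw: "low w" "v \<in> nbr w" using w nbr_sym by (auto simp: low_nbr_def)
    have c5: "card (nbr w) = 5 \<or> card (nbr w) = 6" and cm: "co_matching (nbr w)"
      using low_link lw(1) by (auto simp: low_def)
    have sH: "nbr w \<inter> nbr v \<subseteq> H" using common_nbr_high[OF w] by (simp add: H_def)
    then have "card (nbr w \<inter> nbr v) \<le> card H" using fH by (rule card_mono[rotated])
    then have c: "card (nbr w) = 5" "card H = 3" "card (nbr w \<inter> nbr v) = 3"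
      using card_common_nbr[OF lw] cH c5 by auto
    then have HI: "nbr w \<inter> nbr v = H" using sH fH by (intro card_subset_eq) auto
    have vH: "v \<notin> H" using nbr_irrefl by (auto simp: H_def)
    have "card (nbr w - insert v H) = 1"
      using HI lw(2) vH c fH by (subst card_Diff_subset) auto
    then obtain z where z: "nbr w - insert v H = {z}" by (auto simp: card_1_singleton_iff)
    have "nbr w = insert v (insert z H)" using z HI lw(2) by auto
    moreover have zz: "z \<notin> H" "z \<noteq> v" "z \<notin> nbr v" "z \<in> nbr w" using z HI by auto
    \<comment> \<open>\<open>z\<close> is the only non-neighbour of \<open>v\<close> in the link of
      \<open>w\<close>.\<close>
    moreover have "H \<subseteq> nbr z"
      using low_nonadjacent_unique[OF lw zz(4,3,2)] HI zz vH by auto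
    moreover have "co_matching H" using cm by (rule co_matching_subset) (use HI in auto)
    ultimately show ?thesis using c vH HI by blast
  qed
  obtain W where "W \<subseteq> low_nbr v" "card W = 2"
    using k4 obtain_subset_with_card_n[of 2 "low_nbr v"] by auto
  then obtain u w where uw: "u \<in> low_nbr v" "w \<in> low_nbr v" "u \<noteq> w" by (auto simp: card_2_iff)
  have H: "card H = 3" "co_matching H" "H \<subseteq> nbr v" "v \<notin> H" using key[OF uw(1)] by auto
  obtain y where y: "nbr u = insert v (insert y H)" "y \<notin> H" "y \<noteq> v" "y \<notin> nbr v" "H \<subseteq> nbr y"
    using key[OF uw(1)] by blast
  obtain z where z: "nbr w = insert v (insert z H)" "z \<notin> H" "z \<noteq> v" "z \<notin> nbr v" "H \<subseteq> nbr z"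
    using key[OF uw(2)] by blast
  obtain b c d where bcd: "H = {b, c, d}" "distinct [b, c, d]" "set [{b, d}, {c, d}] \<subseteq> E"
    using co_matching_3[OF H(2,1)] .
  have uwN: "u \<in> nbr v" "w \<in> nbr v" "u \<notin> H" "w \<notin> H"
    using uw by (auto simp: low_nbr_def H_def)
  have uv: "u \<noteq> v" "w \<noteq> v" using uwN nbr_irrefl by auto
  have yz: "y \<noteq> u" "y \<noteq> w" "z \<noteq> u" "z \<noteq> w" using y z uwN by auto
  show False
  proof (cases "y = z")
    case True
    have "nbr u = {v, b, c, d, z}" "nbr w = {v, b, c, d, z}" using y z bcd True by auto
    moreover have "distinct [u, w, v, b, c, d, z]"
      using bcd(1,2) uwN uv yz uw(3) z H(4) by auto
    moreover have "set [{b, d}, {c, d}, {z, b}, {z, c}, {z, d}] \<subseteq> E"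
      using bcd(1,3) z(5) by (simp add: nbr_def)
    ultimately show False using no_5_5_twins by blast
  next
    case False
    have "nbr u = {v, b, c, d, y}" "nbr w = {v, b, c, d, z}" using y z bcd by auto
    moreover have "distinct [u, w, v, b, c, d, y, z]"
      using bcd(1,2) uwN uv yz uw(3) y z H(4) False by auto
    moreover have "set [{v, b}, {v, c}, {v, d}, {b, d}, {c, d}, {z, b}, {z, c}, {z, d}] \<subseteq> E"
      using bcd(1,3) z(5) H(3) by (simp add: nbr_def)
    moreover have "{v, z} \<notin> E" using z(4) by (simp add: nbr_def)
    ultimately show False using no_5_5_common_4 by blast
  qed
qed

text \<open>Four times the charge left after sending 1/4 to each low neighbour: 28 - 3 in degree 7,
  at least 32 - 7 in degree 8, and at least 3 * 9 from degree 9 on.\<close>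

lemma high_vertex_charge:
  assumes "7 \<le> card (nbr v)"
  shows "25 + card (low_nbr v) \<le> 4 * card (nbr v)"
proof -
  have le: "card (low_nbr v) \<le> card (nbr v)"
    by (intro card_mono finite_nbr) (auto simp: low_nbr_def)
  consider "card (nbr v) = 7" | "card (nbr v) = 8" | "9 \<le> card (nbr v)" using assms by linarith
  then show ?thesis
  proof cases
    case 1
    then show ?thesis using card_low_nbr_7 by fastforce
  next
    case 2
    \<comment> \<open>A low neighbour has degree at least 5, so by \<open>card_high_nbr\<close> not
      all eight neighbours are low.\<close>
    have "card (low_nbr v) \<le> 7"
    proof (cases "low_nbr v = {}")
      case False
      then obtain w where w: "w \<in> low_nbr v" by blast
      then have "5 \<le> card (nbr w)" using degree_ge_5 by (auto simp: low_nbr_def low_def)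
      then show ?thesis using card_high_nbr[OF w] 2 by linarith
    qed simp
    then show ?thesis using 2 by simp
  next
    case 3
    then show ?thesis using le by linarith
  qed
qed

section \<open>Double counting and total charge\<close>

lemma handshake: "(\<Sum>v\<in>\<Union>E. card (nbr v)) = 2 * card E"
proof -
  have "card (nbr v) = card {e \<in> E. v \<in> e}" for v
  proof (rule bij_betw_same_card)
    show "bij_betw (\<lambda>w. {v, w}) (nbr v) {e \<in> E. v \<in> e}"
    proof (rule bij_betwI')
      show "\<exists>w\<in>nbr v. e = {v, w}" if e: "e \<in> {e \<in> E. v \<in> e}" for e
      proof -
        obtain a b where "e = {a, b}" using card_edge[of e] e by (auto simp: card_2_iff)
        then show ?thesis using e by (auto simp: nbr_def insert_commute)
      qed
    qed (auto simp: nbr_def doubleton_eq_iff)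
  qed
  then have "(\<Sum>v\<in>\<Union>E. card (nbr v)) = (\<Sum>v\<in>\<Union>E. card {e \<in> E. v \<in> e})" by simp
  also have "\<dots> = (\<Sum>e\<in>E. card {v \<in> \<Union>E. v \<in> e})"
    using sum_multicount_gen[of "\<Union>E" E "\<lambda>v e. v \<in> e" "\<lambda>e. card {v \<in> \<Union>E. v \<in> e}"]
      finite_vertices finite_edges by simp
  also have "\<dots> = (\<Sum>e\<in>E. 2)"
  proof (rule sum.cong)
    fix e assume "e \<in> E"
    then have "{v \<in> \<Union>E. v \<in> e} = e" by blast
    then show "card {v \<in> \<Union>E. v \<in> e} = 2" using card_edge \<open>e \<in> E\<close> by simp
  qed simp
  finally show ?thesis by simp
qed

text \<open>All charges are multiplied by 4. A low vertex of degree d receives from all its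
  neighbours and ends with 4d + d \<ge> 25; the other vertices keep 25 by
  \<open>high_vertex_charge\<close>. The total is four times the degree sum.\<close>

lemma edge_density: "25 * card (\<Union>E) \<le> 8 * card E"
proof -
  define L where "L = {v \<in> \<Union>E. low v}"
  define H where "H = {v \<in> \<Union>E. \<not> low v}"
  have fLH: "finite L" "finite H"
    using finite_vertices unfolding L_def H_def by (rule rev_finite_subset; blast)+
  have part: "\<Union>E = L \<union> H" "L \<inter> H = {}" by (auto simp: L_def H_def)
  have ne: "nbr v \<noteq> {}" if "v \<in> \<Union>E" for v
  proof -
    obtain e where "e \<in> E" "v \<in> e" using \<open>v \<in> \<Union>E\<close> by blast
    moreover obtain a b where "e = {a, b}" using card_edge[OF \<open>e \<in> E\<close>] by (auto simp: card_2_iff)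
    ultimately have "a \<in> nbr v \<or> b \<in> nbr v" by (auto simp: nbr_def insert_commute)
    then show ?thesis by blast
  qed
  \<comment> \<open>Charge sent equals charge received: both sides count the edges between
    \<open>L\<close> and \<open>H\<close>, since no neighbour of a low vertex is low.\<close>
  have "(\<Sum>v\<in>H. card (low_nbr v)) = (\<Sum>w\<in>L. card (nbr w))"
  proof -
    have 1: "low_nbr v = {w \<in> L. w \<in> nbr v}" for v
      by (auto simp: low_nbr_def L_def nbr_def)
    have 2: "nbr w = {v \<in> H. w \<in> nbr v}" if "w \<in> L" for w
    proof -
      have "v \<in> H" if "v \<in> nbr w" for v
        using that low_independent[of w v] \<open>w \<in> L\<close> by (auto simp: L_def H_def nbr_def)
      then show ?thesis using nbr_sym by blast
    qed
    show ?thesis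
      unfolding 1 using sum_multicount_gen[of H L "\<lambda>v w. w \<in> nbr v" "\<lambda>w. card (nbr w)"] fLH 2 by auto
  qed
  moreover have "(\<Sum>v\<in>H. 25 + card (low_nbr v)) \<le> (\<Sum>v\<in>H. 4 * card (nbr v))"
    by (rule sum_mono, rule high_vertex_charge) (use ne in \<open>auto simp: H_def low_def\<close>)
  moreover have "(\<Sum>v\<in>L. 25) \<le> (\<Sum>v\<in>L. 5 * card (nbr v))"
    using degree_ge_5 ne by (intro sum_mono) (auto simp: L_def)
  moreover have "(\<Sum>v\<in>\<Union>E. card (nbr v)) = (\<Sum>v\<in>L. card (nbr v)) + (\<Sum>v\<in>H. card (nbr v))"
    unfolding part(1) using fLH part(2) by (rule sum.union_disjoint)
  moreover have "card (\<Union>E) = card L + card H"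
    unfolding part(1) using fLH part(2) by (rule card_Un_disjoint)
  ultimately show ?thesis
    using handshake by (simp add: sum.distrib sum_distrib_left[symmetric])
qed

end

section \<open>From the minimal counterexample to graphs of bounded density\<close>

text \<open>The density bound passes to subsets of \<open>E\<close>, so induction makes a failing
  \<open>E\<close> critical, and \<open>edge_density\<close> contradicts the bound for
  \<open>F = E\<close>.\<close>

lemma tuza_of_sparse:
  fixes E :: "'a set set"
  assumes "finite E" "\<And>e. e \<in> E \<Longrightarrow> card e = 2"
    and "\<And>F. F \<subseteq> E \<Longrightarrow> F \<noteq> {} \<Longrightarrow> 8 * card F < 25 * card (\<Union>F)"
  shows "tuza E"
  using assms
proof (induction E rule: finite_psubset_induct)
  case (psubset E)
  show ?case
  proof (rule ccontr)
    assume not: "\<not> tuza E"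
    have "tuza F" if "F \<subset> E" for F
      using psubset.IH[OF that] psubset.prems that by (meson psubset_imp_subset subset_eq subset_trans)
    then interpret tuza_critical E
      using psubset.hyps psubset.prems(1) not by unfold_locales blast+
    have "tuza {}"
      by (auto simp: tuza_def triangle_free_def triangles_def tri_edges_def)
    \<comment> \<open>Without edges \<open>edge_density\<close> reads 0 \<le> 0, so the
      contradiction requires a nonempty \<open>E\<close>.\<close>
    then have "E \<noteq> {}" using not by auto
    then show False using edge_density psubset.prems(2)[of E] by auto
  qed
qed

theorem theorem6p1:
  fixes V :: "'a set" and E :: "'a set set"
  assumes "simple_graph V E"
    and "mad V E < 25 / 4"
  shows "tri_cover_number E \<le> 2 * tri_packing_number E"
proof -
  have V: "finite V" and E: "\<And>e. e \<in> E \<Longrightarrow> e \<subseteq> V \<and> card e = 2"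
    using assms(1) by (auto simp: simple_graph_def)
  have "finite E" using E V by (meson Pow_iff finite_Pow_iff finite_subset subsetI)
  have "tuza E"
  proof (rule tuza_of_sparse[OF \<open>finite E\<close>])
    fix F assume F: "F \<subseteq> E" "F \<noteq> {}"
    \<comment> \<open>The subgraph with edges \<open>F\<close> on exactly the vertices
      \<open>\<Union>F\<close> is a competitor in \<open>mad\<close>.\<close>
    have UV: "\<Union>F \<subseteq> V" using F E by blast
    obtain e where "e \<in> F" "e \<noteq> {}" using F E by (metis card.empty ex_in_conv subsetD zero_neq_numeral)
    then have UF: "\<Union>F \<noteq> {}" by blast
    let ?A = "{2 * real (card E') / real (card V') | V' E'.
                   V' \<subseteq> V \<and> V' \<noteq> {} \<and> E' \<subseteq> E \<and> (\<forall>e\<in>E'. e \<subseteq> V')}"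
    have "?A \<subseteq> (\<lambda>(V', E'). 2 * real (card E') / real (card V')) ` (Pow V \<times> Pow E)" by auto
    then have "finite ?A" by (rule finite_subset) (use V \<open>finite E\<close> in auto)
    moreover have "2 * real (card F) / real (card (\<Union>F)) \<in> ?A"
      using UV UF F by blast
    ultimately have "2 * real (card F) / real (card (\<Union>F)) \<le> mad V E"
      unfolding mad_def by (rule Max_ge)
    then have "2 * real (card F) / real (card (\<Union>F)) < 25 / 4" using assms(2) by linarith
    moreover have "0 < card (\<Union>F)" using UF UV V by (meson card_gt_0_iff finite_subset)
    ultimately have "8 * real (card F) < 25 * real (card (\<Union>F))" by (simp add: field_simps)
    then show "8 * card F < 25 * card (\<Union>F)" by linarith
  qed (use E in auto)
  then obtain T Y where T: "T \<subseteq> triangles E" "disjoint T"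
    and Y: "Y \<subseteq> E" "triangle_free (E - Y)" and TY: "card Y \<le> 2 * card T"
    unfolding tuza_def by blast
  \<comment> \<open>Finiteness ensures that \<open>Max\<close> and \<open>Min\<close> bound the
    sizes of the witnesses \<open>T\<close> and \<open>Y\<close>.\<close>
  have "finite (triangles E)"
    by (rule finite_subset[of _ "Pow E"]) (use \<open>finite E\<close> in \<open>auto simp: triangles_def\<close>)
  have "card T \<le> tri_packing_number E"
    unfolding tri_packing_number_def
  proof (rule Max_ge)
    show "finite {card T |T. T \<subseteq> triangles E \<and> disjoint T}"
      by (rule finite_subset[of _ "card ` Pow (triangles E)"])
        (use \<open>finite (triangles E)\<close> in auto)
  qed (use T in blast)
  moreover have "tri_cover_number E \<le> card Y"
    unfolding tri_cover_number_def
  proof (rule Min_le)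
    show "finite {card Y |Y. Y \<subseteq> E \<and> triangle_free (E - Y)}"
      by (rule finite_subset[of _ "card ` Pow E"]) (use \<open>finite E\<close> in auto)
  qed (use Y in blast)
  ultimately show ?thesis using TY by linarith
qed

end
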